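(* Let $A$ be a complex unital $*$-algebra and let $f$ and $g$ be positive linear functionals on $A$ such that their GNS representations $\pi_f$ and $\pi_g$ are essentially self-adjoint. Let $\pi$ be a biclosed $*$-representation of $A$ such that the sets $S(\pi,f)$ and $S(\pi,g)$ are not empty. Fix vectors $\varphi\in S(\pi,f)$ and $\psi\in S(\pi,g)$. Then $$P_A(f,g)=\sup_{T\in \pi(A)'_{ss},\ \|T\|\le 1} |\langle T\varphi,\psi\rangle|^2 .$$
   Context: $A$ is a complex unital $*$-algebra with involution $a\mapsto a^+$ and unit $1$. A linear functional $f$ on $A$ is positive if $f(a^+a)\ge 0$ for all $a\in A$; $\mathcal P(A)$ is the set of positive linear functionals. Inner products are linear in the first variable. A $*$-representation $\pi$ of $A$ on a complex inner product space $\mathcal D(\pi)$ with Hilbert space completion $\mathcal H(\pi)$ is an algebra homomorphism of $A$ into the linear operators $\mathcal D(\pi)\to\mathcal D(\pi)$ with $\pi(1)=I$ and $\langle\pi(a)\varphi,\psi\rangle=\langle\varphi,\pi(a^+)\psi\rangle$ for $a\in A$, $\varphi,\psi\in\mathcal D(\pi)$. The operators $\pi(a)$ may be unbounded; $\overline{\pi(a)}$ denotes the operator closure in $\mathcal H(\pi)$. Adjoint representation: $\mathcal D(\pi^* )=\bigcap_{a\in A}\mathcal D(\pi(a)^* )$, $\pi^*(a)=\pi(a^+)^*\lceil\mathcal D(\pi^* )$. Biclosure: $\mathcal D(\pi^{**})=\bigcap_{a\in A}\mathcal D(\pi^*(a)^* )$, $\pi^{**}(a)=\pi^*(a^+)^*\lceil\mathcal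 D(\pi^{**})$. One has $\pi\subseteq\pi^{**}\subseteq\pi^*$. $\pi$ is called biclosed if $\pi=\pi^{**}$, and essentially self-adjoint if $\pi^*=\pi^{**}$ (equivalently $\mathcal D(\pi^{**})=\mathcal D(\pi^* )$). Symmetrized commutant: $\pi(A)'_{ss}$ is the set of bounded operators $T$ on $\mathcal H(\pi)$ such that $T\,\overline{\pi(a)}\subseteq\overline{\pi(a)}\,T$ and $T^*\,\overline{\pi(a)}\subseteq\overline{\pi(a)}\,T^*$ for all $a\in A$. GNS representation: for $f\in\mathcal P(A)$, $\pi_f$ is the (up to unitary equivalence unique) $*$-representation with a vector $\varphi_f$ such that $\mathcal D(\pi_f)=\pi_f(A)\varphi_f$ and $f(a)=\langle\pi_f(a)\varphi_f,\varphi_f\rangle$ for all $a\in A$. For a $*$-representation $\pi$ and $f\in\mathcal P(A)$, $S(\pi,f)$ is the set of all $\varphi\in\mathcal D(\pi)$ with $f(a)=\langle\pi(a)\varphi,\varphi\rangle$ for all $a\in A$. The transition probability of $f,g\in\mathcal P(A)$ is $$P_A(f,g)=\sup_{\pi}\ \sup_{\varphi\in S(\pi,f),\,\psi\in S(\pi,g)}|\langle\varphi,\psi\rangle|^2,$$ where $\pi$ ranges over all $*$-representations of $A$. *)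

theory Defs
  imports "HOL-Analysis.Analysis"
begin

section \<open>Complex vector spaces, complex *-algebras, complex Hilbert spaces\<close>

class complex_vector = ab_group_add +
  fixes scaleC :: "complex \<Rightarrow> 'a \<Rightarrow> 'a" (infixr "*\<^sub>C" 75)
  assumes scaleC_add_right: "c *\<^sub>C (x + y) = c *\<^sub>C x + c *\<^sub>C y"
    and scaleC_add_left: "(c + d) *\<^sub>C x = c *\<^sub>C x + d *\<^sub>C x"
    and scaleC_scaleC: "c *\<^sub>C d *\<^sub>C x = (c * d) *\<^sub>C x"
    and scaleC_one: "1 *\<^sub>C x = x"

global_interpretation complex_vector: vector_space "scaleC :: complex \<Rightarrow> 'a \<Rightarrow> 'a::complex_vector"
  by unfold_locales
    (simp_all add: scaleC_add_right scaleC_add_left scaleC_scaleC scaleC_one)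

instantiation prod :: (complex_vector, complex_vector) complex_vector
begin

definition scaleC_prod_def: "c *\<^sub>C x = (c *\<^sub>C fst x, c *\<^sub>C snd x)"

instance
  by standard (simp_all add: scaleC_prod_def scaleC_add_right scaleC_add_left
      scaleC_scaleC scaleC_one prod_eq_iff)

end

(* "ring + monoid_mult" instead of ring_1: the zero algebra is not excluded. *)
class complex_star_algebra = complex_vector + ring + monoid_mult +
  fixes invol :: "'a \<Rightarrow> 'a"
  assumes mult_scaleC_left: "(c *\<^sub>C a) * b = c *\<^sub>C (a * b)"
    and mult_scaleC_right: "a * (c *\<^sub>C b) = c *\<^sub>C (a * b)"
    and invol_invol: "invol (invol a) = a"
    and invol_add: "invol (a + b) = invol a + invol b"
    and invol_scaleC: "invol (c *\<^sub>C a) = cnj c *\<^sub>C invol a"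
    and invol_mult: "invol (a * b) = invol b * invol a"

(* The real structure is the one underlying the complex one, so that norm and topology of
   the real inner product space are the usual ones: (norm x)^2 = cinner x x. *)
class complex_hilbert = real_inner + complete_space + complex_vector +
  fixes cinner :: "'a \<Rightarrow> 'a \<Rightarrow> complex"
  assumes scaleR_scaleC: "r *\<^sub>R x = complex_of_real r *\<^sub>C x"
    and inner_Re_cinner: "inner x y = Re (cinner x y)"
    and cinner_add_left: "cinner (x + y) z = cinner x z + cinner y z"
    and cinner_scaleC_left: "cinner (c *\<^sub>C x) y = c * cinner x y"
    and cinner_commute: "cinner x y = cnj (cinner y x)"


section \<open>Positive functionals and *-representations\<close>

definition positive_functional :: "('a::complex_star_algebra \<Rightarrow> complex) \<Rightarrow> bool" where
  "positive_functional f \<longleftrightarrow>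
     Vector_Spaces.linear scaleC (*) f \<and> (\<forall>a. f (invol a * a) \<in> \<real>\<^sub>\<ge>\<^sub>0)"

(* An inner product space is given by a linear subspace D of an ambient vector space together
   with an arbitrary inner product on D, which is unrelated to any structure of the ambient
   space. The values of ip and of the representing operators outside D are irrelevant. *)
locale inner_product_on =
  fixes D :: "'v::complex_vector set" and ip :: "'v \<Rightarrow> 'v \<Rightarrow> complex"
  assumes subspace: "complex_vector.subspace D"
    and ip_add_left: "\<lbrakk>x \<in> D; y \<in> D; z \<in> D\<rbrakk> \<Longrightarrow> ip (x + y) z = ip x z + ip y z"
    and ip_scaleC_left: "\<lbrakk>x \<in> D; y \<in> D\<rbrakk> \<Longrightarrow> ip (c *\<^sub>C x) y = c * ip x y"
    and ip_commute: "\<lbrakk>x \<in> D; y \<in> D\<rbrakk> \<Longrightarrow> ip x y = cnj (ip y x)"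
    and ip_nonneg: "x \<in> D \<Longrightarrow> ip x x \<in> \<real>\<^sub>\<ge>\<^sub>0"
    and ip_definite: "\<lbrakk>x \<in> D; ip x x = 0\<rbrakk> \<Longrightarrow> x = 0"

locale star_rep = inner_product_on D ip
  for D :: "'v::complex_vector set" and ip +
  fixes \<pi> :: "'a::complex_star_algebra \<Rightarrow> 'v \<Rightarrow> 'v"
  assumes rep_closed: "x \<in> D \<Longrightarrow> \<pi> a x \<in> D"
    and rep_linear_add: "\<lbrakk>x \<in> D; y \<in> D\<rbrakk> \<Longrightarrow> \<pi> a (x + y) = \<pi> a x + \<pi> a y"
    and rep_linear_scaleC: "x \<in> D \<Longrightarrow> \<pi> a (c *\<^sub>C x) = c *\<^sub>C \<pi> a x"
    and rep_add: "x \<in> D \<Longrightarrow> \<pi> (a + b) x = \<pi> a x + \<pi> b x"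
    and rep_scaleC: "x \<in> D \<Longrightarrow> \<pi> (c *\<^sub>C a) x = c *\<^sub>C \<pi> a x"
    and rep_mult: "x \<in> D \<Longrightarrow> \<pi> (a * b) x = \<pi> a (\<pi> b x)"
    and rep_one: "x \<in> D \<Longrightarrow> \<pi> 1 x = x"
    and rep_invol: "\<lbrakk>x \<in> D; y \<in> D\<rbrakk> \<Longrightarrow> ip (\<pi> a x) y = ip x (\<pi> (invol a) y)"

definition realizing_vectors ::
  "'v set \<Rightarrow> ('v \<Rightarrow> 'v \<Rightarrow> complex) \<Rightarrow> ('a \<Rightarrow> 'v \<Rightarrow> 'v) \<Rightarrow> ('a \<Rightarrow> complex) \<Rightarrow> 'v set" where
  "realizing_vectors D ip \<pi> f = {\<phi> \<in> D. \<forall>a. f a = ip (\<pi> a \<phi>) \<phi>}"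

(* HOL cannot quantify over representations on all types at once. It suffices to let the
   representation space be a subspace of the vector space 'a \<times> 'a (with an arbitrary inner
   product): see transition_probability_upper below, which shows that representations on
   any other type do not give larger values. *)
definition transition_probability ::
  "('a::complex_star_algebra \<Rightarrow> complex) \<Rightarrow> ('a \<Rightarrow> complex) \<Rightarrow> real" where
  "transition_probability f g =
     Sup {(cmod (ip \<phi> \<psi>))\<^sup>2 | (D :: ('a \<times> 'a) set) ip \<pi> \<phi> \<psi>.
            star_rep D ip \<pi> \<and> \<phi> \<in> realizing_vectors D ip \<pi> f \<and> \<psi> \<in> realizing_vectors D ip \<pi> g}"


section \<open>Unbounded operators and *-representations on Hilbert spaces\<close>

(* Operators are represented by their graphs, so that the composition S T is the relational
   composition (graph T) O (graph S) and extension of operators is inclusion of graphs. *)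

definition op_graph :: "'h set \<Rightarrow> ('h \<Rightarrow> 'h) \<Rightarrow> ('h \<times> 'h) set" where
  "op_graph D T = {(x, T x) | x. x \<in> D}"

definition op_adjoint :: "('h::complex_hilbert \<times> 'h) set \<Rightarrow> ('h \<times> 'h) set" where
  "op_adjoint G = {(y, z). \<forall>(x, w) \<in> G. cinner w y = cinner x z}"

(* The completion of D is the whole Hilbert space 'h. *)
definition hilbert_star_rep ::
  "'h::complex_hilbert set \<Rightarrow> ('a::complex_star_algebra \<Rightarrow> 'h \<Rightarrow> 'h) \<Rightarrow> bool" where
  "hilbert_star_rep D \<pi> \<longleftrightarrow> star_rep D cinner \<pi> \<and> closure D = UNIV"

definition rep_graph :: "'h set \<Rightarrow> ('a \<Rightarrow> 'h \<Rightarrow> 'h) \<Rightarrow> 'a \<Rightarrow> ('h \<times> 'h) set" where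
  "rep_graph D \<pi> = (\<lambda>a. op_graph D (\<pi> a))"

(* For R = rep_graph D \<pi> this is the adjoint representation, and applying it twice gives
   the biclosure. *)
definition adjoint_rep ::
  "('a::complex_star_algebra \<Rightarrow> ('h::complex_hilbert \<times> 'h) set) \<Rightarrow> 'a \<Rightarrow> ('h \<times> 'h) set" where
  "adjoint_rep R = (\<lambda>a. {(y, z) \<in> op_adjoint (R (invol a)). y \<in> (\<Inter>b. Domain (op_adjoint (R b)))})"

definition biclosed ::
  "'h::complex_hilbert set \<Rightarrow> ('a::complex_star_algebra \<Rightarrow> 'h \<Rightarrow> 'h) \<Rightarrow> bool" where
  "biclosed D \<pi> \<longleftrightarrow> rep_graph D \<pi> = adjoint_rep (adjoint_rep (rep_graph D \<pi>))"

definition essentially_self_adjoint ::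
  "'h::complex_hilbert set \<Rightarrow> ('a::complex_star_algebra \<Rightarrow> 'h \<Rightarrow> 'h) \<Rightarrow> bool" where
  "essentially_self_adjoint D \<pi> \<longleftrightarrow>
     adjoint_rep (rep_graph D \<pi>) = adjoint_rep (adjoint_rep (rep_graph D \<pi>))"

definition gns_representation ::
  "('a::complex_star_algebra \<Rightarrow> complex) \<Rightarrow> 'h::complex_hilbert set \<Rightarrow> ('a \<Rightarrow> 'h \<Rightarrow> 'h) \<Rightarrow> 'h \<Rightarrow> bool"
  where
  "gns_representation f D \<pi> \<xi> \<longleftrightarrow>
     hilbert_star_rep D \<pi> \<and> \<xi> \<in> D \<and> D = range (\<lambda>a. \<pi> a \<xi>) \<and> (\<forall>a. f a = cinner (\<pi> a \<xi>) \<xi>)"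

definition bounded_clinear :: "('h::complex_hilbert \<Rightarrow> 'h) \<Rightarrow> bool" where
  "bounded_clinear T \<longleftrightarrow> bounded_linear T \<and> (\<forall>c x. T (c *\<^sub>C x) = c *\<^sub>C T x)"

(* closure is the topological closure in 'h \<times> 'h, i.e. the graph of the operator closure. *)
definition symmetrized_commutant ::
  "'h::complex_hilbert set \<Rightarrow> ('a::complex_star_algebra \<Rightarrow> 'h \<Rightarrow> 'h) \<Rightarrow> ('h \<Rightarrow> 'h) set" where
  "symmetrized_commutant D \<pi> =
     {T. bounded_clinear T \<and>
         (\<forall>a. let P = closure (op_graph D (\<pi> a)); G = op_graph UNIV T in
            P O G \<subseteq> G O P \<and> P O op_adjoint G \<subseteq> op_adjoint G O P)}"


section \<open>The supremum over all representations\<close>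

context inner_product_on
begin

lemma ip_add_right: "\<lbrakk>x \<in> D; y \<in> D; z \<in> D\<rbrakk> \<Longrightarrow> ip x (y + z) = ip x y + ip x z"
  using ip_commute[of x "y + z"] ip_commute[of x y] ip_commute[of x z] ip_add_left[of y z x]
    complex_vector.subspace_add[OF subspace, of y z] by simp

lemma ip_scaleC_right: "\<lbrakk>x \<in> D; y \<in> D\<rbrakk> \<Longrightarrow> ip x (c *\<^sub>C y) = cnj c * ip x y"
  using ip_commute[of x "c *\<^sub>C y"] ip_commute[of x y] ip_scaleC_left[of y x c]
    complex_vector.subspace_scale[OF subspace, of y c] by simp

lemma cauchy_schwarz:
  assumes x: "x \<in> D" and y: "y \<in> D"
  shows "(cmod (ip x y))\<^sup>2 \<le> Re (ip x x) * Re (ip y y)"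
proof -
  have scl: "c *\<^sub>C u \<in> D" if "u \<in> D" for c u
    using complex_vector.subspace_scale[OF subspace that] .
  have re: "ip u u = complex_of_real (Re (ip u u))" "Re (ip u u) \<ge> 0" if "u \<in> D" for u
    using ip_nonneg[OF that] by (auto simp: complex_nonneg_Reals_iff complex_eq_iff)
  define p q r where "p = Re (ip x x)" and "q = Re (ip y y)" and "r = ip x y"
  have px: "ip x x = of_real p" "p \<ge> 0" and qy: "ip y y = of_real q" "q \<ge> 0"
    using re[OF x] re[OF y] unfolding p_def q_def by auto
  have yx: "ip y x = cnj r" using ip_commute[OF y x] by (simp add: r_def)
  show ?thesis
  proof (cases "q = 0")
    case True
    then have "y = 0" using ip_definite[OF y] qy by simp
    then have "ip x y = 0" using ip_scaleC_right[OF x y, of 0] by simp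
    then show ?thesis using px qy by simp
  next
    case False
    define v where "v = of_real q *\<^sub>C x + (- r) *\<^sub>C y"
    have m: "of_real q *\<^sub>C x \<in> D" "(- r) *\<^sub>C y \<in> D" using scl x y by blast+
    have vD: "v \<in> D" unfolding v_def using complex_vector.subspace_add[OF subspace m] .
    have "ip v v = of_real q * of_real q * of_real p - of_real q * cnj r * r
          - r * of_real q * cnj r + r * cnj r * of_real q"
      unfolding v_def using m x y vD[unfolded v_def]
      by (simp add: ip_add_left ip_add_right ip_scaleC_left ip_scaleC_right px(1) qy(1) yx
          r_def[symmetric] algebra_simps del: complex_vector.scale_minus_left)
    also have "\<dots> = of_real (q * (q * p - (cmod r)\<^sup>2))"
      using complex_norm_square[of r] by (simp add: algebra_simps)
    finally have "0 \<le> q * (q * p - (cmod r)\<^sup>2)"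
      using re(2)[OF vD] by simp
    then have "(cmod r)\<^sup>2 \<le> q * p"
      using False qy(2) by (simp add: zero_le_mult_iff)
    then show ?thesis by (simp add: p_def q_def r_def mult.commute)
  qed
qed

end

lemma (in star_rep) realizing_overlap_le:
  assumes "\<phi> \<in> realizing_vectors D ip \<pi> f" "\<psi> \<in> realizing_vectors D ip \<pi> g"
  shows "(cmod (ip \<phi> \<psi>))\<^sup>2 \<le> Re (f 1) * Re (g 1)"
  using cauchy_schwarz[of \<phi> \<psi>] assms rep_one by (simp add: realizing_vectors_def)

lemma transition_probability_bdd_above:
  "bdd_above {(cmod (ip \<phi> \<psi>))\<^sup>2 | (D :: ('v::complex_vector) set) ip
      (\<pi> :: 'a::complex_star_algebra \<Rightarrow> 'v \<Rightarrow> 'v) \<phi> \<psi>.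
      star_rep D ip \<pi> \<and> \<phi> \<in> realizing_vectors D ip \<pi> f \<and> \<psi> \<in> realizing_vectors D ip \<pi> g}"
  by (rule bdd_aboveI[where M = "Re (f 1) * Re (g 1)"])
    (auto intro: star_rep.realizing_overlap_le)

lemma star_rep_on_pairs:
  fixes D :: "'v::complex_vector set" and \<pi> :: "'a::complex_star_algebra \<Rightarrow> 'v \<Rightarrow> 'v"
  assumes "star_rep D ip \<pi>"
    and phi: "\<phi> \<in> realizing_vectors D ip \<pi> f" and psi: "\<psi> \<in> realizing_vectors D ip \<pi> g"
  obtains D' :: "('a \<times> 'a) set" and ip' \<pi>' \<phi>' \<psi>' where
    "star_rep D' ip' \<pi>'" "\<phi>' \<in> realizing_vectors D' ip' \<pi>' f"
    "\<psi>' \<in> realizing_vectors D' ip' \<pi>' g" "ip' \<phi>' \<psi>' = ip \<phi> \<psi>"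
proof -
  interpret star_rep D ip \<pi> by fact
  have D[simp]: "\<phi> \<in> D" "\<psi> \<in> D" using phi psi by (auto simp: realizing_vectors_def)
  have add[simp]: "x + y \<in> D" if "x \<in> D" "y \<in> D" for x y
    using complex_vector.subspace_add[OF subspace that] .
  note rep_closed[simp]
  define q where "q = (\<lambda>p. \<pi> (fst p) \<phi> + \<pi> (snd p) \<psi>)"
  have linq: "Vector_Spaces.linear scaleC scaleC q"
    by unfold_locales
      (simp_all add: q_def scaleC_prod_def rep_add rep_scaleC scaleC_add_right algebra_simps)
  obtain h where h: "Vector_Spaces.linear scaleC scaleC h" and qh: "\<And>p. q (h (q p)) = q p"
  proof -
    interpret vp: vector_space_pair "scaleC :: complex \<Rightarrow> 'a \<times> 'a \<Rightarrow> _"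
      "scaleC :: complex \<Rightarrow> 'v \<Rightarrow> _" ..
    show ?thesis
      using that vp.linear_exists_right_inverse_on[OF linq complex_vector.subspace_UNIV] by auto
  qed
  interpret q: Vector_Spaces.linear scaleC scaleC q by fact
  interpret h: Vector_Spaces.linear scaleC scaleC h by fact
  have qD[simp]: "q p \<in> D" for p by (simp add: q_def)
  have pq: "\<pi> c (q p) = q (c * fst p, c * snd p)" for c p
    by (simp add: q_def rep_linear_add rep_mult)
  define D' where "D' = range (\<lambda>p. h (q p))"
  define ip' where "ip' = (\<lambda>x y. ip (q x) (q y))"
  define \<pi>' where "\<pi>' = (\<lambda>a x. h (\<pi> a (q x)))"
  have q1: "\<phi> = q (1, 0)" "\<psi> = q (0, 1)"
    using rep_one rep_scaleC[of \<phi> 0 0] rep_scaleC[of \<psi> 0 0] by (simp_all add: q_def)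
  have qpi: "q (\<pi>' a x) = \<pi> a (q x)" for a x
    by (simp add: \<pi>'_def pq qh)
  have hq: "h (q x) = x" if "x \<in> D'" for x
    using that by (auto simp: D'_def qh)
  have rep': "star_rep D' ip' \<pi>'"
  proof unfold_locales
    show "complex_vector.subspace D'"
      using h.subspace_image[OF q.subspace_image[OF complex_vector.subspace_UNIV]]
      by (simp add: D'_def image_image)
    show "x = 0" if "x \<in> D'" "ip' x x = 0" for x
    proof -
      have "q x = 0" using that ip_definite[of "q x"] by (simp add: ip'_def)
      then show ?thesis using hq[OF that(1)] h.zero by simp
    qed
    show "\<pi>' a x \<in> D'" for a x
      unfolding D'_def \<pi>'_def pq by blast
    show "ip' x y = cnj (ip' y x)" for x y
      by (simp add: ip'_def ip_commute[symmetric])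
    show "\<pi>' 1 x = x" if "x \<in> D'" for x
      using hq[OF that] by (simp add: \<pi>'_def rep_one)
    show "ip' (\<pi>' a x) y = ip' x (\<pi>' (invol a) y)" for a x y
      by (simp add: ip'_def qpi rep_invol)
    show "\<pi>' (a * b) x = \<pi>' a (\<pi>' b x)" for a b x
      by (metis \<pi>'_def qpi qD rep_mult)
  qed (simp_all add: ip'_def \<pi>'_def q.add q.scale h.add h.scale ip_add_left ip_scaleC_left
      ip_nonneg rep_linear_add rep_linear_scaleC rep_add rep_scaleC)
  have q\<phi>: "q (h \<phi>) = \<phi>" and q\<psi>: "q (h \<psi>) = \<psi>" using q1 qh by metis+
  have "h \<phi> \<in> D'" "h \<psi> \<in> D'" unfolding D'_def using q1 by blast+
  then have "h \<phi> \<in> realizing_vectors D' ip' \<pi>' f" "h \<psi> \<in> realizing_vectors D' ip' \<pi>' g"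
    using phi psi by (auto simp: realizing_vectors_def ip'_def qpi q\<phi> q\<psi>)
  then show ?thesis using that[OF rep'] by (simp add: ip'_def q\<phi> q\<psi>)
qed

lemma transition_probability_upper:
  fixes D :: "'v::complex_vector set" and \<pi> :: "'a::complex_star_algebra \<Rightarrow> 'v \<Rightarrow> 'v"
  assumes "star_rep D ip \<pi>"
    and "\<phi> \<in> realizing_vectors D ip \<pi> f" and "\<psi> \<in> realizing_vectors D ip \<pi> g"
  shows "(cmod (ip \<phi> \<psi>))\<^sup>2 \<le> transition_probability f g"
proof -
  obtain D' :: "('a \<times> 'a) set" and ip' \<pi>' \<phi>' \<psi>' where
    "star_rep D' ip' \<pi>'" "\<phi>' \<in> realizing_vectors D' ip' \<pi>' f"
    "\<psi>' \<in> realizing_vectors D' ip' \<pi>' g" "ip \<phi> \<psi> = ip' \<phi>' \<psi>'"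
    using star_rep_on_pairs[OF assms] by metis
  then show ?thesis
    unfolding transition_probability_def
    by (intro cSup_upper transition_probability_bdd_above CollectI)
      (metis (no_types, lifting))
qed

end

theory Submission
  imports Defs
begin

text \<open>Let \<open>U\<close> and \<open>V\<close> be the canonical isometries of the GNS spaces of \<open>f\<close> and \<open>g\<close> into the space of \<open>\<pi>\<close>.
  Vectors \<open>x, y\<close> of a representation \<open>\<rho>\<close> realizing \<open>f\<close> and \<open>g\<close> give a contraction \<open>C\<close> between the GNS
  spaces by \<open>\<langle>C \<pi>\<^sub>f(a)\<phi>\<^sub>f, \<pi>\<^sub>g(b)\<phi>\<^sub>g\<rangle> = \<langle>\<rho>(a)x, \<rho>(b)y\<rangle>\<close>, and \<open>T = V C U\<^sup>*\<close> satisfies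
  \<open>\<langle>T\<phi>, \<psi>\<rangle> = \<langle>x, y\<rangle>\<close>. Essential self-adjointness of \<open>\<pi>\<^sub>f\<close>, \<open>\<pi>\<^sub>g\<close> and biclosedness of \<open>\<pi>\<close> upgrade weak
  intertwining to invariance of the domain, first for \<open>U C\<^sup>*\<close> and \<open>V C\<close>, then for \<open>T\<close> and \<open>T\<^sup>*\<close>.
  Conversely, a contraction \<open>T\<close> in the commutant twists the inner product of \<open>\<pi> \<oplus> \<pi>\<close> so that \<open>(\<phi>, 0)\<close> and
  \<open>(0, \<psi>)\<close> have overlap \<open>\<langle>T\<phi>, \<psi>\<rangle>\<close>.\<close>

section \<open>Complex Hilbert spaces\<close>

text \<open>Conjugate symmetry makes \<open>cinner x x\<close> real, and its real part is the real
  inner product. This gives access to \<open>cauchy_schwarz\<close> for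
  \<open>cinner\<close>.\<close>

lemma inner_product_on_cinner: "inner_product_on UNIV (cinner :: 'h::complex_hilbert \<Rightarrow> _)"
proof
  show "cinner x x \<in> \<real>\<^sub>\<ge>\<^sub>0" for x :: 'h
  proof -
    have "Im (cinner x x) = - Im (cinner x x)"
      by (metis cinner_commute cnj.simps(2))
    then show ?thesis
      using inner_ge_zero[of x] by (simp add: inner_Re_cinner complex_nonneg_Reals_iff)
  qed
  show "x = 0" if "cinner x x = 0" for x :: 'h
    using that inner_Re_cinner[of x x] by simp
qed (simp_all add: cinner_add_left cinner_scaleC_left, rule cinner_commute)

global_interpretation cinner: inner_product_on UNIV "cinner :: 'h::complex_hilbert \<Rightarrow> 'h \<Rightarrow> complex"
  by (rule inner_product_on_cinner)

lemma cinner_add_right: "cinner (x::'h::complex_hilbert) (y + z) = cinner x y + cinner x z"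
  by (rule cinner.ip_add_right) auto

lemma cinner_scaleC_right: "cinner (x::'h::complex_hilbert) (c *\<^sub>C y) = cnj c * cinner x y"
  by (rule cinner.ip_scaleC_right) auto

lemma cinner_self: "cinner (x::'h::complex_hilbert) x = of_real ((norm x)\<^sup>2)"
proof (rule complex_eqI)
  show "Re (cinner x x) = Re (of_real ((norm x)\<^sup>2))"
    unfolding Re_complex_of_real power2_norm_eq_inner by (rule inner_Re_cinner[symmetric])
  show "Im (cinner x x) = Im (of_real ((norm x)\<^sup>2))"
    using cinner.ip_nonneg[of x] by (simp add: complex_nonneg_Reals_iff)
qed

lemma cmod_cinner_le: "cmod (cinner (x::'h::complex_hilbert) y) \<le> norm x * norm y"
  using cinner.cauchy_schwarz[of x y]
  by - (rule power2_le_imp_le, simp_all add: cinner_self power_mult_distrib)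

lemma bounded_linear_cinner_left: "bounded_linear (\<lambda>x::'h::complex_hilbert. cinner x y)"
  by (rule bounded_linear_intro[where K = "norm y"])
    (simp_all add: cinner_add_left scaleR_scaleC cinner_scaleC_left scaleR_conv_of_real cmod_cinner_le)

text \<open>By continuity, agreement of the real inner products passes from \<open>S\<close> to its
  closure; testing against \<open>x - y\<close> then finishes.\<close>

lemma cinner_eqI_dense:
  fixes x y :: "'h::complex_hilbert"
  assumes dense: "closure S = UNIV" and eq: "\<And>s. s \<in> S \<Longrightarrow> cinner s x = cinner s y"
  shows "x = y"
proof -
  have "closed {s. inner s x = inner s y}"
    by (intro closed_Collect_eq continuous_intros)
  moreover have "S \<subseteq> {s. inner s x = inner s y}"
    using eq by (simp add: inner_Re_cinner subset_iff)
  ultimately have "closure S \<subseteq> {s. inner s x = inner s y}"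
    by (rule closure_minimal[rotated])
  then have "inner s (x - y) = 0" for s
    using dense by (auto simp: inner_diff_right)
  from this[of "x - y"] show ?thesis by simp
qed

lemmas cinner_eqI = cinner_eqI_dense[OF closure_UNIV]

section \<open>Complex-linear maps and Riesz representation along a linear map\<close>

lemma complex_linearD:
  assumes "Vector_Spaces.linear scaleC s p"
  shows "p (x + y) = p x + p y" "p (c *\<^sub>C x) = s c (p x)"
proof -
  interpret Vector_Spaces.linear scaleC s p by (rule assms)
  show "p (x + y) = p x + p y" by (rule add)
  show "p (c *\<^sub>C x) = s c (p x)" by (rule scale)
qed

lemma complex_linearI:
  fixes p :: "'b::complex_vector \<Rightarrow> 'h::complex_vector"
  assumes "\<And>x y. p (x + y) = p x + p y" "\<And>c x. p (c *\<^sub>C x) = c *\<^sub>C p x"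
  shows "Vector_Spaces.linear scaleC scaleC p"
  by unfold_locales (simp_all add: assms)

lemma complex_functionalI:
  fixes L :: "'b::complex_vector \<Rightarrow> complex"
  assumes "\<And>x y. L (x + y) = L x + L y" "\<And>c x. L (c *\<^sub>C x) = c * L x"
  shows "Vector_Spaces.linear scaleC (*) L"
  by unfold_locales (simp_all add: assms algebra_simps)

text \<open>The vector is the limit of the images under \<open>p\<close> of a minimizing sequence of
  \<open>\<parallel>p a\<parallel>\<^sup>2 - 2 Re (L a)\<close>; no closedness of the range of \<open>p\<close> is involved.\<close>

lemma riesz_on_range:
  fixes p :: "'b::complex_vector \<Rightarrow> 'h::complex_hilbert" and L :: "'b \<Rightarrow> complex"
  assumes p: "Vector_Spaces.linear scaleC scaleC p" and L: "Vector_Spaces.linear scaleC (*) L"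
    and K: "K \<ge> 0" and bound: "\<And>a. cmod (L a) \<le> K * norm (p a)"
  shows "\<exists>z. (\<forall>a. L a = cinner (p a) z) \<and> norm z \<le> K"
proof -
  note pl = complex_linearD[OF p] and Ll = complex_linearD[OF L]
  define J where "J = (\<lambda>a. (norm (p a))\<^sup>2 - 2 * Re (L a))"
  define m where "m = (INF a. J a)"
  have "J a \<ge> - K\<^sup>2" for a
  proof -
    have "Re (L a) \<le> K * norm (p a)"
      using bound[of a] complex_Re_le_cmod[of "L a"] by linarith
    moreover have "0 \<le> (norm (p a) - K)\<^sup>2" by simp
    ultimately show ?thesis unfolding J_def by (simp add: power2_diff mult.commute)
  qed
  then have bdd: "bdd_below (range J)" by (intro bdd_belowI2)
  then have m_le: "m \<le> J a" for a unfolding m_def by (rule cINF_lower) simp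
  have "\<exists>a. J a < m + 1 / real (Suc n)" for n
    using cINF_less_iff[OF _ bdd, of "m + 1 / real (Suc n)"] unfolding m_def by auto
  then obtain s where s: "\<And>n. J (s n) < m + 1 / real (Suc n)" by metis
  have J_shift: "J (a + complex_of_real t *\<^sub>C c)
      = J a + 2 * t * (inner (p a) (p c) - Re (L c)) + t\<^sup>2 * (norm (p c))\<^sup>2" for a c t
  proof -
    have "(norm (u + t *\<^sub>R v))\<^sup>2 = (norm u)\<^sup>2 + 2 * t * inner u v + t\<^sup>2 * (norm v)\<^sup>2"
      for u v :: 'h
      unfolding power2_norm_eq_inner
      by (simp add: inner_simps inner_commute[of v u] power2_eq_square algebra_simps del: dot_square_norm)
    then show ?thesis
      by (simp add: J_def pl Ll algebra_simps flip: scaleR_scaleC)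
  qed
  \<comment> \<open>Parallelogram law for \<open>p a\<close> and \<open>p b\<close>; the terms with
    \<open>L\<close> cancel at the midpoint.\<close>
  have J_mid: "(norm (p a - p b))\<^sup>2 = 2 * J a + 2 * J b - 4 * J (complex_of_real (1/2) *\<^sub>C (a + b))"
    for a b
  proof -
    have "(norm (u - v))\<^sup>2 = 2 * (norm u)\<^sup>2 + 2 * (norm v)\<^sup>2 - 4 * (norm ((1/2) *\<^sub>R (u + v)))\<^sup>2"
      for u v :: 'h
      unfolding power2_norm_eq_inner
      by (simp add: inner_simps inner_commute[of v u] field_simps del: dot_square_norm)
    moreover have "p (complex_of_real (1/2) *\<^sub>C (a + b)) = (1/2) *\<^sub>R (p a + p b)"
      by (simp only: pl scaleR_scaleC)
    moreover have "Re (L (complex_of_real (1/2) *\<^sub>C (a + b))) = (Re (L a) + Re (L b)) / 2"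
      by (simp add: Ll)
    ultimately show ?thesis unfolding J_def by simp
  qed
  \<comment> \<open>Two values of \<open>J\<close> close to the infimum \<open>m\<close>, with
    \<open>J\<close> at least \<open>m\<close> at the midpoint, force the images under
    \<open>p\<close> to be close.\<close>
  have dist: "(norm (p (s i) - p (s j)))\<^sup>2 \<le> 4 / real (Suc n)" if "i \<ge> n" "j \<ge> n" for i j n
  proof -
    have "1 / real (Suc i) \<le> 1 / real (Suc n)" "1 / real (Suc j) \<le> 1 / real (Suc n)"
      using that by (auto intro!: divide_left_mono)
    then show ?thesis
      using s[of i] s[of j] m_le[of "complex_of_real (1/2) *\<^sub>C (s i + s j)"]
      unfolding J_mid by simp
  qed
  have "Cauchy (\<lambda>n. p (s n))"
  proof (rule CauchyI)
    fix e :: real assume e: "e > 0"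
    obtain n where n: "4 / e\<^sup>2 < real (Suc n)"
      using reals_Archimedean2 less_trans lessI of_nat_less_iff by metis
    then have "4 / real (Suc n) < e\<^sup>2"
      using e by (simp add: field_simps)
    then have "norm (p (s i) - p (s j)) < e" if "i \<ge> n" "j \<ge> n" for i j
      using dist[OF that] e by - (rule power_less_imp_less_base[of _ 2 e], auto)
    then show "\<exists>M. \<forall>i\<ge>M. \<forall>j\<ge>M. norm (p (s i) - p (s j)) < e" by blast
  qed
  then obtain z where z: "(\<lambda>n. p (s n)) \<longlonglongrightarrow> z"
    using Cauchy_convergent_iff convergent_def by blast
  have Jm: "(\<lambda>n. J (s n)) \<longlonglongrightarrow> m"
  proof (rule tendsto_sandwich[where f = "\<lambda>_. m"])
    show "(\<lambda>n. m + 1 / real (Suc n)) \<longlonglongrightarrow> m"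
      using tendsto_add[OF tendsto_const LIMSEQ_inverse_real_of_nat, of m]
      by (simp add: inverse_eq_divide)
  qed (use m_le s in \<open>auto intro!: always_eventually less_imp_le\<close>)
  \<comment> \<open>First variation: \<open>d\<close> is half the derivative at \<open>t = 0\<close>
    of the limit of \<open>J\<close> along the direction \<open>c\<close>, and it vanishes because
    \<open>m\<close> is a lower bound.\<close>
  have re: "Re (L c) = inner (p c) z" for c
  proof -
    define d where "d = inner z (p c) - Re (L c)"
    have quad: "0 \<le> 2 * t * d + t\<^sup>2 * (norm (p c))\<^sup>2" for t
    proof -
      have "(\<lambda>n. J (s n + complex_of_real t *\<^sub>C c)) \<longlonglongrightarrow> m + 2 * t * d + t\<^sup>2 * (norm (p c))\<^sup>2"
        unfolding J_shift d_def by (intro tendsto_intros Jm z)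
      then show ?thesis
        using LIMSEQ_le_const m_le by fastforce
    qed
    have "d = 0"
    proof (rule ccontr)
      assume "d \<noteq> 0"
      \<comment> \<open>The summand 1 keeps \<open>q\<close> positive even if
        \<open>p c = 0\<close>, so that the step \<open>- d / q\<close> can be taken.\<close>
      define q where "q = (norm (p c))\<^sup>2 + 1"
      have q: "q > 0" unfolding q_def by (simp add: add_nonneg_pos)
      have "0 \<le> 2 * (- d / q) * d + (- d / q)\<^sup>2 * (q - 1)"
        using quad[of "- d / q"] by (simp add: q_def)
      also have "\<dots> = - (d\<^sup>2 / q) - (d / q)\<^sup>2"
        using q by (simp add: field_simps power2_eq_square)
      also have "\<dots> < 0"
      proof -
        have "0 < d\<^sup>2 / q" using q \<open>d \<noteq> 0\<close> by simp
        then show ?thesis using zero_le_power2[of "d / q"] by linarith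
      qed
      finally show False by simp
    qed
    then show ?thesis by (simp add: d_def inner_commute)
  qed
  have "L c = cinner (p c) z" for c
  proof (rule complex_eqI)
    show "Re (L c) = Re (cinner (p c) z)" using re inner_Re_cinner by metis
    show "Im (L c) = Im (cinner (p c) z)"
      using re[of "\<i> *\<^sub>C c"] by (simp add: pl Ll inner_Re_cinner cinner_scaleC_left)
  qed
  moreover have "norm z \<le> K"
  proof -
    \<comment> \<open>In the limit this becomes \<open>inner z z \<le> K * norm z\<close>, which
      bounds \<open>norm z\<close> by \<open>K\<close>.\<close>
    have "inner (p (s n)) z \<le> K * norm (p (s n))" for n
      using bound[of "s n"] complex_Re_le_cmod[of "L (s n)"] re[of "s n"] by linarith
    then have "inner z z \<le> K * norm z"
      by (intro LIMSEQ_le[OF tendsto_inner[OF z tendsto_const] tendsto_mult[OF tendsto_const tendsto_norm[OF z]]])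
        auto
    then have "norm z * norm z \<le> K * norm z"
      by (simp add: power2_eq_square flip: power2_norm_eq_inner)
    then show ?thesis using K by (cases "z = 0") auto
  qed
  ultimately show ?thesis by blast
qed

section \<open>Contractions and their adjoints\<close>

lemma bounded_clinearI:
  fixes T :: "'h::complex_hilbert \<Rightarrow> 'h"
  assumes "Vector_Spaces.linear scaleC scaleC T" "\<And>x. norm (T x) \<le> norm x"
  shows "bounded_clinear T"
  unfolding bounded_clinear_def
  using complex_linearD[OF assms(1)] assms(2)
  by (auto intro!: bounded_linear_intro[where K = 1] simp: scaleR_scaleC)

text \<open>The adjoint travels with the map as a second contraction, possibly between different
  spaces, so that composing and passing to adjoints act on pairs.\<close>

definition adjoint_contractions ::
  "('h::complex_hilbert \<Rightarrow> 'k::complex_hilbert) \<Rightarrow> ('k \<Rightarrow> 'h) \<Rightarrow> bool" where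
  "adjoint_contractions T T' \<longleftrightarrow>
     (\<forall>x y. cinner (T x) y = cinner x (T' y)) \<and>
     Vector_Spaces.linear scaleC scaleC T \<and> (\<forall>x. norm (T x) \<le> norm x) \<and>
     Vector_Spaces.linear scaleC scaleC T' \<and> (\<forall>y. norm (T' y) \<le> norm y)"

lemma cinner_adjoint_left:
  "adjoint_contractions T T' \<Longrightarrow> cinner (T x) y = cinner x (T' y)"
  by (simp add: adjoint_contractions_def)

lemma cinner_adjoint_right:
  "adjoint_contractions T T' \<Longrightarrow> cinner (T' y) x = cinner y (T x)"
  by (metis adjoint_contractions_def cinner_commute)

lemma adjoint_contractions_sym: "adjoint_contractions T T' \<Longrightarrow> adjoint_contractions T' T"
  using cinner_adjoint_right[of T T'] by (auto simp: adjoint_contractions_def)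

lemma adjoint_contractions_comp:
  assumes "adjoint_contractions S S'" "adjoint_contractions T T'"
  shows "adjoint_contractions (\<lambda>x. S (T x)) (\<lambda>y. T' (S' y))"
  using assms unfolding adjoint_contractions_def
  by (auto intro!: complex_linearI simp: complex_linearD intro: order_trans)

text \<open>Riesz along \<open>p\<close>, for the functionals \<open>cinner (q a) y\<close>, yields
  \<open>T'\<close>; Riesz along the identity then yields \<open>T\<close> as its adjoint. The bound
  \<open>le\<close> contains the well-definedness of sending \<open>p a\<close> to
  \<open>q a\<close>.\<close>

lemma adjoint_contractions_extend:
  fixes p :: "'b::complex_vector \<Rightarrow> 'h::complex_hilbert" and q :: "'b \<Rightarrow> 'k::complex_hilbert"
  assumes p: "Vector_Spaces.linear scaleC scaleC p" and dense: "closure (range p) = UNIV"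
    and q: "Vector_Spaces.linear scaleC scaleC q" and le: "\<And>a. norm (q a) \<le> norm (p a)"
  obtains T T' where "adjoint_contractions T T'" "\<And>a. T (p a) = q a"
proof -
  note ql = complex_linearD[OF q]
  have "\<exists>z. (\<forall>a. cinner (q a) y = cinner (p a) z) \<and> norm z \<le> norm y" for y
    by (rule riesz_on_range[OF p])
      (auto intro!: complex_functionalI order_trans[OF cmod_cinner_le]
        simp: ql cinner_add_left cinner_scaleC_left mult.commute mult_left_mono le)
  then obtain T' where T': "\<And>a y. cinner (q a) y = cinner (p a) (T' y)"
    and T'_le: "\<And>y. norm (T' y) \<le> norm y" by metis
  have T'_lin: "Vector_Spaces.linear scaleC scaleC T'"
    by (rule complex_linearI; rule cinner_eqI_dense[OF dense])
      (auto simp: cinner_add_right cinner_scaleC_right simp flip: T')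
  note Tl = complex_linearD[OF T'_lin]
  have "\<exists>z. (\<forall>y. cinner (T' y) x = cinner y z) \<and> norm z \<le> norm x" for x
    by (rule riesz_on_range[of "\<lambda>y. y"])
      (auto intro!: complex_functionalI complex_linearI order_trans[OF cmod_cinner_le]
        simp: Tl cinner_add_left cinner_scaleC_left mult.commute mult_left_mono T'_le)
  then obtain T where T: "\<And>x y. cinner (T' y) x = cinner y (T x)"
    and T_le: "\<And>x. norm (T x) \<le> norm x" by metis
  have T_lin: "Vector_Spaces.linear scaleC scaleC T"
    by (rule complex_linearI; rule cinner_eqI)
      (auto simp: cinner_add_right cinner_scaleC_right simp flip: T)
  have adj: "cinner (T x) y = cinner x (T' y)" for x y
    using T cinner_commute by metis
  have "T (p a) = q a" for a
    by (rule cinner_eqI) (metis T T' cinner_commute)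
  with that show thesis
    using adj T_lin T_le T'_lin T'_le unfolding adjoint_contractions_def by blast
qed

text \<open>Riesz in the second variable represents the form by vectors \<open>z a\<close>, and
  sending \<open>p a\<close> to \<open>z a\<close> extends to the whole space. The conjugate in
  \<open>B_right\<close> turns the antilinear second variable into a linear one.\<close>

lemma adjoint_contractions_of_form:
  fixes p :: "'b::complex_vector \<Rightarrow> 'h::complex_hilbert" and q :: "'b \<Rightarrow> 'k::complex_hilbert"
    and B :: "'b \<Rightarrow> 'b \<Rightarrow> complex"
  assumes p: "Vector_Spaces.linear scaleC scaleC p" "closure (range p) = UNIV"
    and q: "Vector_Spaces.linear scaleC scaleC q" "closure (range q) = UNIV"
    and B_left: "\<And>b. Vector_Spaces.linear scaleC (*) (\<lambda>a. B a b)"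
    and B_right: "\<And>a. Vector_Spaces.linear scaleC (*) (\<lambda>b. cnj (B a b))"
    and le: "\<And>a b. cmod (B a b) \<le> norm (p a) * norm (q b)"
  obtains T T' where "adjoint_contractions T T'" "\<And>a b. cinner (T (p a)) (q b) = B a b"
proof -
  have "\<exists>z. (\<forall>b. cnj (B a b) = cinner (q b) z) \<and> norm z \<le> norm (p a)" for a
    by (rule riesz_on_range[OF q(1) B_right]) (simp_all add: le)
  then obtain z where z: "\<And>a b. cnj (B a b) = cinner (q b) (z a)"
    and z_le: "\<And>a. norm (z a) \<le> norm (p a)" by metis
  have "Vector_Spaces.linear scaleC scaleC z"
    by (rule complex_linearI; rule cinner_eqI_dense[OF q(2)])
      (auto simp: cinner_add_right cinner_scaleC_right complex_linearD[OF B_left] simp flip: z)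
  then obtain T T' where T: "adjoint_contractions T T'" "\<And>a. T (p a) = z a"
    using adjoint_contractions_extend[OF p _ z_le] by metis
  have "cinner (z a) (q b) = B a b" for a b
    using z cinner_commute complex_cnj_cnj by metis
  with that T show thesis by metis
qed

section \<open>Orbits of vectors and the adjoint representation\<close>

lemma (in star_rep) rep_invol': "\<lbrakk>x \<in> D; y \<in> D\<rbrakk> \<Longrightarrow> ip x (\<pi> a y) = ip (\<pi> (invol a) x) y"
  using rep_invol[of x y "invol a"] by (simp add: invol_invol)

text \<open>Inner products along an orbit depend on \<open>f\<close> alone, so orbits of vectors
  realizing \<open>f\<close> in different representations are isometric.\<close>

lemma (in star_rep) ip_orbit:
  assumes "x \<in> realizing_vectors D ip \<pi> f"
  shows "ip (\<pi> a x) (\<pi> b x) = f (invol b * a)"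
  using assms by (simp add: realizing_vectors_def rep_invol' rep_closed rep_mult)

lemma (in star_rep) orbit_linear:
  assumes "x \<in> D"
  shows "Vector_Spaces.linear scaleC scaleC (\<lambda>a. \<pi> a x)"
  using assms by (intro complex_linearI) (simp_all add: rep_add rep_scaleC)

lemma gns_representationD:
  assumes "gns_representation f D \<pi> \<xi>"
  shows "star_rep D cinner \<pi>" "closure D = UNIV" "\<xi> \<in> realizing_vectors D cinner \<pi> f"
    "D = range (\<lambda>a. \<pi> a \<xi>)"
  using assms by (auto simp: gns_representation_def hilbert_star_rep_def realizing_vectors_def)

text \<open>Membership at a single \<open>a\<close> involves the adjoints at all algebra elements,
  so the witness \<open>z\<close> is a whole family. Since \<open>invol\<close> is its own inverse,
  the elements \<open>invol b\<close> exhaust the algebra.\<close>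

lemma adjoint_repI:
  assumes "\<And>b x w. (x, w) \<in> R (invol b) \<Longrightarrow> cinner w y = cinner x (z b)"
  shows "(y, z a) \<in> adjoint_rep R a"
proof -
  have "(y, z b) \<in> op_adjoint (R (invol b))" for b
    using assms by (auto simp: op_adjoint_def)
  then have "y \<in> Domain (op_adjoint (R b))" for b
    by (metis DomainI invol_invol)
  then show ?thesis
    using \<open>(y, z a) \<in> op_adjoint (R (invol a))\<close> by (auto simp: adjoint_rep_def)
qed

lemma adjoint_rep_rep_graphD:
  assumes "(y, z) \<in> adjoint_rep (rep_graph D \<pi>) a" "x \<in> D"
  shows "cinner (\<pi> (invol a) x) y = cinner x z"
  using assms by (auto simp: adjoint_rep_def rep_graph_def op_graph_def op_adjoint_def)

text \<open>Values are chosen at every \<open>b\<close>, and the choice is then overwritten at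
  \<open>a\<close> to pass through the given \<open>z\<close>.\<close>

lemma adjoint_rep_domainE:
  assumes "(y, z) \<in> adjoint_rep R a"
  obtains z' where "\<And>b. (y, z' b) \<in> adjoint_rep R b" "z' a = z"
proof -
  have y: "y \<in> (\<Inter>b. Domain (op_adjoint (R b)))"
    using assms by (auto simp: adjoint_rep_def)
  have "\<exists>w. (y, w) \<in> adjoint_rep R b" for b
    using y by (fastforce simp: adjoint_rep_def)
  then obtain z' where "\<And>b. (y, z' b) \<in> adjoint_rep R b" by metis
  then show thesis
    using assms by (intro that[of "z'(a := z)"]) auto
qed

text \<open>The adjoint of an intertwiner \<open>U\<close> maps the domain of \<open>\<pi>\<^sup>*\<close> into that of \<open>\<rho>\<^sup>*\<close>; hence \<open>U\<close> maps
  the domain of \<open>\<rho>\<^sup>*\<^sup>*\<close>, which is that of \<open>\<rho>\<^sup>*\<close>, into the domain of \<open>\<pi>\<^sup>*\<^sup>* = \<pi>\<close>.\<close>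

lemma intertwiner_maps_adjoint_domain:
  fixes \<pi> :: "'a::complex_star_algebra \<Rightarrow> 'h::complex_hilbert \<Rightarrow> 'h"
    and \<rho> :: "'a \<Rightarrow> 'k::complex_hilbert \<Rightarrow> 'k"
  assumes U: "adjoint_contractions U U'"
    and UD: "\<And>y. y \<in> E \<Longrightarrow> U y \<in> D" and U_comm: "\<And>a y. y \<in> E \<Longrightarrow> U (\<rho> a y) = \<pi> a (U y)"
    and ess: "essentially_self_adjoint E \<rho>" and bi: "biclosed D \<pi>"
    and adj: "\<And>a y. y \<in> E \<Longrightarrow> cinner (\<rho> (invol a) y) z = cinner y (w a)"
  shows "U z \<in> D" and "\<pi> a (U z) = U (w a)"
proof -
  \<comment> \<open>The hypothesis \<open>adj\<close> puts \<open>z\<close> into the domain of the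
    adjoint of \<rho>, with values \<open>w a\<close>.\<close>
  have "(z, w a) \<in> adjoint_rep (rep_graph E \<rho>) a" for a
    by (rule adjoint_repI) (use adj in \<open>auto simp: rep_graph_def op_graph_def\<close>)
  then have zw: "(z, w a) \<in> adjoint_rep (adjoint_rep (rep_graph E \<rho>)) a" for a
    using ess by (simp add: essentially_self_adjoint_def)
  have U': "(U' y, U' v) \<in> adjoint_rep (rep_graph E \<rho>) b"
    if yv: "(y, v) \<in> adjoint_rep (rep_graph D \<pi>) b" for y v b
  proof -
    obtain v' where v': "\<And>c. (y, v' c) \<in> adjoint_rep (rep_graph D \<pi>) c" and vb: "v' b = v"
      using adjoint_rep_domainE[OF yv] by blast
    have "(U' y, U' (v' b)) \<in> adjoint_rep (rep_graph E \<rho>) b"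
      by (rule adjoint_repI[where z = "\<lambda>c. U' (v' c)"])
        (use adjoint_rep_rep_graphD[OF v'] UD in
          \<open>auto simp: rep_graph_def op_graph_def U_comm simp flip: cinner_adjoint_left[OF U]\<close>)
    then show ?thesis by (simp add: vb)
  qed
  have "(U z, U (w a)) \<in> adjoint_rep (adjoint_rep (rep_graph D \<pi>)) a" for a
  proof (rule adjoint_repI[where z = "\<lambda>b. U (w b)"])
    fix b y v assume "(y, v) \<in> adjoint_rep (rep_graph D \<pi>) (invol b)"
    then have "cinner (U' v) z = cinner (U' y) (w b)"
      using U' zw[of b] by (fastforce simp: adjoint_rep_def[of "adjoint_rep _"] op_adjoint_def)
    then show "cinner v (U z) = cinner y (U (w b))"
      by (simp add: cinner_adjoint_right[OF U])
  qed
  then have "(U z, U (w a)) \<in> rep_graph D \<pi> a" for a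
    using bi by (simp add: biclosed_def)
  then show "U z \<in> D" and "\<pi> a (U z) = U (w a)"
    by (auto simp: rep_graph_def op_graph_def)
qed

text \<open>The orbits of \<open>\<xi>\<close> and \<open>x\<close> have equal norms because both
  vectors realize \<open>f\<close>, so mapping one orbit to the other extends to a contraction that
  intertwines the representations.\<close>

lemma gns_embedding:
  fixes \<pi> :: "'a::complex_star_algebra \<Rightarrow> 'h::complex_hilbert \<Rightarrow> 'h"
    and \<rho> :: "'a \<Rightarrow> 'k::complex_hilbert \<Rightarrow> 'k"
  assumes gns: "gns_representation f E \<rho> \<xi>" and rep: "star_rep D cinner \<pi>"
    and x: "x \<in> realizing_vectors D cinner \<pi> f"
  obtains U U' where "adjoint_contractions U U'" "U' x = \<xi>"
    "\<And>y. y \<in> E \<Longrightarrow> U y \<in> D" "\<And>a y. y \<in> E \<Longrightarrow> U (\<rho> a y) = \<pi> a (U y)"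
proof -
  note g = gns_representationD[OF gns]
  interpret \<rho>: star_rep E cinner \<rho> by (rule g(1))
  interpret \<pi>: star_rep D cinner \<pi> by (rule rep)
  have \<xi>: "\<xi> \<in> E" and xD: "x \<in> D" using g(3) x by (auto simp: realizing_vectors_def)
  have "(norm (\<pi> a x))\<^sup>2 = (norm (\<rho> a \<xi>))\<^sup>2" for a
    using \<pi>.ip_orbit[OF x, of a a] \<rho>.ip_orbit[OF g(3), of a a] unfolding cinner_self
    by (metis of_real_eq_iff)
  then have le: "norm (\<pi> a x) \<le> norm (\<rho> a \<xi>)" for a
    by (simp add: order.eq_iff)
  have dense: "closure (range (\<lambda>a. \<rho> a \<xi>)) = UNIV" using g by simp
  obtain U U' where U: "adjoint_contractions U U'" and Up: "\<And>a. U (\<rho> a \<xi>) = \<pi> a x"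
    using adjoint_contractions_extend[OF \<rho>.orbit_linear[OF \<xi>] dense \<pi>.orbit_linear[OF xD] le] by blast
  show thesis
  proof (rule that[OF U])
    \<comment> \<open>Both sides equal \<open>f a\<close>.\<close>
    have "cinner (\<rho> a \<xi>) (U' x) = cinner (\<rho> a \<xi>) \<xi>" for a
      using x g(3) by (simp add: Up realizing_vectors_def flip: cinner_adjoint_left[OF U])
    then show "U' x = \<xi>" by (intro cinner_eqI_dense[OF dense]) auto
    show "U y \<in> D" if "y \<in> E" for y
      using that g(4) Up xD \<pi>.rep_closed by auto
    show "U (\<rho> a y) = \<pi> a (U y)" if "y \<in> E" for a y
    proof -
      obtain b where "y = \<rho> b \<xi>" using \<open>y \<in> E\<close> unfolding g(4) by blast
      then show ?thesis
        using Up[of "a * b"] by (simp add: Up \<rho>.rep_mult[OF \<xi>] \<pi>.rep_mult[OF xD])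
    qed
  qed
qed

section \<open>From overlaps to the symmetrized commutant\<close>

text \<open>Commutation on the domain says that \<open>map_prod S S\<close> preserves the graph of
  \<open>\<pi> a\<close>; by continuity it preserves the closure, for \<open>S\<close> equal to
  \<open>T\<close> as well as \<open>T'\<close>.\<close>

lemma symmetrized_commutantI:
  fixes \<pi> :: "'a::complex_star_algebra \<Rightarrow> 'h::complex_hilbert \<Rightarrow> 'h"
  assumes T: "adjoint_contractions T T'"
    and T_D: "\<And>x. x \<in> D \<Longrightarrow> T x \<in> D" "\<And>a x. x \<in> D \<Longrightarrow> \<pi> a (T x) = T (\<pi> a x)"
    and T'_D: "\<And>x. x \<in> D \<Longrightarrow> T' x \<in> D" "\<And>a x. x \<in> D \<Longrightarrow> \<pi> a (T' x) = T' (\<pi> a x)"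
  shows "T \<in> symmetrized_commutant D \<pi>"
proof -
  have bd: "bounded_clinear T" "bounded_clinear T'"
    using T by (auto intro!: bounded_clinearI simp: adjoint_contractions_def)
  have step: "closure (op_graph D (\<pi> a)) O op_graph UNIV S \<subseteq> op_graph UNIV S O closure (op_graph D (\<pi> a))"
    if bd: "bounded_clinear S" and S: "\<And>x. x \<in> D \<Longrightarrow> S x \<in> D" "\<And>x. x \<in> D \<Longrightarrow> \<pi> a (S x) = S (\<pi> a x)"
    for S a
  proof -
    have "bounded_linear S" using bd by (simp add: bounded_clinear_def)
    then have "continuous_on UNIV S" by (rule linear_continuous_on)
    then have cont: "continuous_on UNIV (map_prod S S)"
      by (auto intro!: continuous_intros intro: continuous_on_compose2
          simp: map_prod_def case_prod_unfold)
    have "map_prod S S ` op_graph D (\<pi> a) \<subseteq> op_graph D (\<pi> a)"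
      using S by (auto simp: op_graph_def)
    then have "map_prod S S ` closure (op_graph D (\<pi> a)) \<subseteq> closure (op_graph D (\<pi> a))"
      by (intro image_closure_subset continuous_on_subset[OF cont])
        (auto intro: closure_subset[THEN subsetD])
    then show ?thesis by (fastforce simp: op_graph_def)
  qed
  have "z = T' y" if "\<And>x. cinner (T x) y = cinner x z" for y z
    by (rule cinner_eqI) (metis that cinner_adjoint_left[OF T])
  then have "op_adjoint (op_graph UNIV T) = op_graph UNIV T'"
    by (auto simp: op_adjoint_def op_graph_def cinner_adjoint_left[OF T])
  then show ?thesis
    using bd step[OF bd(1) T_D] step[OF bd(2) T'_D]
    by (simp add: symmetrized_commutant_def Let_def)
qed

text \<open>The contraction \<open>C\<close> maps \<open>D\<^sub>f\<close> only into the domain of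
  the adjoint of \<open>\<pi>\<^sub>g\<close>, possibly outside \<open>D\<^sub>g\<close>. Applying
  \<open>V\<close> brings the vectors into \<open>D\<close>; in the same way \<open>U\<close>
  corrects \<open>C'\<close>.\<close>

lemma overlap_realized_by_commutant:
  fixes f g :: "'a::complex_star_algebra \<Rightarrow> complex"
    and \<pi>\<^sub>f :: "'a \<Rightarrow> 'hf::complex_hilbert \<Rightarrow> 'hf" and \<pi>\<^sub>g :: "'a \<Rightarrow> 'hg::complex_hilbert \<Rightarrow> 'hg"
    and \<pi> :: "'a \<Rightarrow> 'h::complex_hilbert \<Rightarrow> 'h"
    and E :: "'v::complex_vector set"
  assumes f: "gns_representation f D\<^sub>f \<pi>\<^sub>f \<phi>\<^sub>f" "essentially_self_adjoint D\<^sub>f \<pi>\<^sub>f"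
    and g: "gns_representation g D\<^sub>g \<pi>\<^sub>g \<phi>\<^sub>g" "essentially_self_adjoint D\<^sub>g \<pi>\<^sub>g"
    and rep: "star_rep D cinner \<pi>" and bi: "biclosed D \<pi>"
    and \<phi>: "\<phi> \<in> realizing_vectors D cinner \<pi> f" and \<psi>: "\<psi> \<in> realizing_vectors D cinner \<pi> g"
    and \<rho>: "star_rep E ip \<rho>"
    and x: "x \<in> realizing_vectors E ip \<rho> f" and y: "y \<in> realizing_vectors E ip \<rho> g"
  shows "\<exists>T \<in> symmetrized_commutant D \<pi>. onorm T \<le> 1 \<and> cinner (T \<phi>) \<psi> = ip x y"
proof -
  note Gf = gns_representationD[OF f(1)] and Gg = gns_representationD[OF g(1)]
  interpret \<pi>f: star_rep D\<^sub>f cinner \<pi>\<^sub>f by (rule Gf)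
  interpret \<pi>g: star_rep D\<^sub>g cinner \<pi>\<^sub>g by (rule Gg)
  interpret \<pi>: star_rep D cinner \<pi> by (rule rep)
  interpret \<rho>: star_rep E ip \<rho> by (rule \<rho>)
  have \<phi>f: "\<phi>\<^sub>f \<in> D\<^sub>f" and \<phi>g: "\<phi>\<^sub>g \<in> D\<^sub>g" and xE: "x \<in> E" and yE: "y \<in> E"
    using Gf(3) Gg(3) x y by (auto simp: realizing_vectors_def)
  note [simp] = \<rho>.rep_closed[OF xE] \<rho>.rep_closed[OF yE]
  define B where "B = (\<lambda>a b. ip (\<rho> a x) (\<rho> b y))"
  \<comment> \<open>The norms of orbit vectors agree in \<rho> and in the GNS spaces, so this is
    Cauchy-Schwarz for \<open>ip\<close>.\<close>
  have le: "cmod (B a b) \<le> norm (\<pi>\<^sub>f a \<phi>\<^sub>f) * norm (\<pi>\<^sub>g b \<phi>\<^sub>g)" for a b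
  proof -
    have "ip (\<rho> a x) (\<rho> a x) = of_real ((norm (\<pi>\<^sub>f a \<phi>\<^sub>f))\<^sup>2)"
      "ip (\<rho> b y) (\<rho> b y) = of_real ((norm (\<pi>\<^sub>g b \<phi>\<^sub>g))\<^sup>2)"
      using \<rho>.ip_orbit[OF x] \<pi>f.ip_orbit[OF Gf(3)] \<rho>.ip_orbit[OF y] \<pi>g.ip_orbit[OF Gg(3)]
      unfolding cinner_self[symmetric] by simp_all
    then show ?thesis
      using \<rho>.cauchy_schwarz[of "\<rho> a x" "\<rho> b y"] unfolding B_def
      by - (rule power2_le_imp_le, simp_all add: power_mult_distrib)
  qed
  have B_left: "Vector_Spaces.linear scaleC (*) (\<lambda>a. B a b)" for b
    by (rule complex_functionalI)
      (simp_all add: B_def \<rho>.rep_add[OF xE] \<rho>.rep_scaleC[OF xE] \<rho>.ip_add_left \<rho>.ip_scaleC_left)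
  have B_right: "Vector_Spaces.linear scaleC (*) (\<lambda>b. cnj (B a b))" for a
    by (rule complex_functionalI)
      (simp_all add: B_def \<rho>.rep_add[OF yE] \<rho>.rep_scaleC[OF yE] \<rho>.ip_add_right \<rho>.ip_scaleC_right)
  have dense: "closure (range (\<lambda>a. \<pi>\<^sub>f a \<phi>\<^sub>f)) = UNIV" "closure (range (\<lambda>a. \<pi>\<^sub>g a \<phi>\<^sub>g)) = UNIV"
    using Gf Gg by simp_all
  obtain C C' where C: "adjoint_contractions C C'"
    and CB: "\<And>a b. cinner (C (\<pi>\<^sub>f a \<phi>\<^sub>f)) (\<pi>\<^sub>g b \<phi>\<^sub>g) = B a b"
    using adjoint_contractions_of_form[OF \<pi>f.orbit_linear[OF \<phi>f] dense(1)
        \<pi>g.orbit_linear[OF \<phi>g] dense(2) B_left B_right le] by blast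
  \<comment> \<open>Weak intertwining, tested on orbit vectors: moving \<open>a\<close> across
    \<open>ip\<close> gives \<open>B (a * b) c = B b (invol a * c)\<close>.\<close>
  have C_comm: "cinner (C (\<pi>\<^sub>f a u)) v = cinner (C u) (\<pi>\<^sub>g (invol a) v)"
    if "u \<in> D\<^sub>f" "v \<in> D\<^sub>g" for a u v
  proof -
    obtain b c where uv: "u = \<pi>\<^sub>f b \<phi>\<^sub>f" "v = \<pi>\<^sub>g c \<phi>\<^sub>g" 
      using \<open>u \<in> D\<^sub>f\<close> \<open>v \<in> D\<^sub>g\<close> unfolding Gf(4) Gg(4) by blast
    have "B (a * b) c = B b (invol a * c)"
      by (simp add: B_def \<rho>.rep_mult xE yE \<rho>.rep_invol invol_mult)
    then show ?thesis
      using CB[of "a * b" c] CB[of b "invol a * c"]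
      by (simp add: uv \<pi>f.rep_mult[OF \<phi>f] \<pi>g.rep_mult[OF \<phi>g])
  qed
  obtain U U' where U: "adjoint_contractions U U'" and U'\<phi>: "U' \<phi> = \<phi>\<^sub>f"
    and U_D: "\<And>y. y \<in> D\<^sub>f \<Longrightarrow> U y \<in> D" "\<And>a y. y \<in> D\<^sub>f \<Longrightarrow> U (\<pi>\<^sub>f a y) = \<pi> a (U y)"
    using gns_embedding[OF f(1) rep \<phi>] by blast
  obtain V V' where V: "adjoint_contractions V V'" and V'\<psi>: "V' \<psi> = \<phi>\<^sub>g"
    and V_D: "\<And>y. y \<in> D\<^sub>g \<Longrightarrow> V y \<in> D" "\<And>a y. y \<in> D\<^sub>g \<Longrightarrow> V (\<pi>\<^sub>g a y) = \<pi> a (V y)"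
    using gns_embedding[OF g(1) rep \<psi>] by blast
  note KU = intertwiner_maps_adjoint_domain[OF U U_D f(2) bi]
    and KV = intertwiner_maps_adjoint_domain[OF V V_D g(2) bi]
  note adj = cinner_adjoint_left[OF C] cinner_adjoint_right[OF C] cinner_adjoint_left[OF U]
    cinner_adjoint_right[OF U] cinner_adjoint_left[OF V] cinner_adjoint_right[OF V]
  have UC': "U (C' v) \<in> D" "\<pi> a (U (C' v)) = U (C' (\<pi>\<^sub>g a v))" if "v \<in> D\<^sub>g" for a v
  proof -
    have *: "cinner (\<pi>\<^sub>f (invol a) u) (C' v) = cinner u (C' (\<pi>\<^sub>g a v))" if "u \<in> D\<^sub>f" for a u
      using C_comm[OF that \<open>v \<in> D\<^sub>g\<close>, of "invol a"] by (simp add: adj(1) invol_invol)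
    show "U (C' v) \<in> D" "\<pi> a (U (C' v)) = U (C' (\<pi>\<^sub>g a v))"
      by (rule KU[OF _ _ *]; simp)+
  qed
  have VC: "V (C u) \<in> D" "\<pi> a (V (C u)) = V (C (\<pi>\<^sub>f a u))" if "u \<in> D\<^sub>f" for a u
  proof -
    have *: "cinner (\<pi>\<^sub>g (invol a) v) (C u) = cinner v (C (\<pi>\<^sub>f a u))" if "v \<in> D\<^sub>g" for a v
      using C_comm[OF \<open>u \<in> D\<^sub>f\<close> that, of a] by (metis cinner_commute)
    show "V (C u) \<in> D" "\<pi> a (V (C u)) = V (C (\<pi>\<^sub>f a u))"
      by (rule KV[OF _ _ *]; simp)+
  qed
  define T T' where "T = (\<lambda>x. V (C (U' x)))" and "T' = (\<lambda>x. U (C' (V' x)))"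
  have T: "adjoint_contractions T T'"
    unfolding T_def T'_def
    using adjoint_contractions_comp[OF V adjoint_contractions_comp[OF C adjoint_contractions_sym[OF U]]] .
  have T_D: "T x \<in> D" "\<pi> a (T x) = T (\<pi> a x)" if "x \<in> D" for a x
  proof -
    \<comment> \<open>As \<open>U' x\<close> may lie outside \<open>D\<^sub>f\<close>,
      \<open>C_comm\<close> does not apply. The operators are moved to the side of \<open>v\<close>
      instead, where \<open>UC'\<close> gives a vector of \<open>D\<close> on which \<pi> can
      act.\<close>
    have *: "cinner (\<pi>\<^sub>g (invol a) v) (C (U' x)) = cinner v (C (U' (\<pi> a x)))" if "v \<in> D\<^sub>g" for a v
    proof -
      have "cinner (\<pi>\<^sub>g (invol a) v) (C (U' x)) = cinner (\<pi> (invol a) (U (C' v))) x"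
        by (simp add: UC' that flip: adj)
      also have "\<dots> = cinner (U (C' v)) (\<pi> a x)"
        using \<pi>.rep_invol[OF UC'(1)[OF that] \<open>x \<in> D\<close>, of "invol a"] by (simp add: invol_invol)
      finally show ?thesis by (simp add: adj)
    qed
    show "T x \<in> D" "\<pi> a (T x) = T (\<pi> a x)"
      unfolding T_def by (rule KV[OF _ _ *]; simp)+
  qed
  have T'_D: "T' x \<in> D" "\<pi> a (T' x) = T' (\<pi> a x)" if "x \<in> D" for a x
  proof -
    have *: "cinner (\<pi>\<^sub>f (invol a) u) (C' (V' x)) = cinner u (C' (V' (\<pi> a x)))" if "u \<in> D\<^sub>f" for a u
    proof -
      have "cinner (\<pi>\<^sub>f (invol a) u) (C' (V' x)) = cinner (\<pi> (invol a) (V (C u))) x"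
        by (simp add: VC that flip: adj)
      also have "\<dots> = cinner (V (C u)) (\<pi> a x)"
        using \<pi>.rep_invol[OF VC(1)[OF that] \<open>x \<in> D\<close>, of "invol a"] by (simp add: invol_invol)
      finally show ?thesis by (simp add: adj)
    qed
    show "T' x \<in> D" "\<pi> a (T' x) = T' (\<pi> a x)"
      unfolding T'_def by (rule KU[OF _ _ *]; simp)+
  qed
  have "onorm T \<le> 1"
    by (rule onorm_bound) (use T in \<open>simp_all add: adjoint_contractions_def\<close>)
  \<comment> \<open>The adjoints return \<open>\<phi>\<close> and \<open>\<psi>\<close> to the GNS
    vectors, and \<open>B 1 1\<close> is the given overlap.\<close>
  moreover have "cinner (T \<phi>) \<psi> = ip x y"
    using CB[of 1 1] \<phi>f \<phi>g xE yE
    by (simp add: T_def adj(5) U'\<phi> V'\<psi> B_def \<pi>f.rep_one \<pi>g.rep_one \<rho>.rep_one)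
  moreover have "T \<in> symmetrized_commutant D \<pi>"
    by (rule symmetrized_commutantI[OF T]) (simp_all add: T_D T'_D)
  ultimately show ?thesis by blast
qed

section \<open>Contractions in the commutant as overlaps\<close>

text \<open>\<open>T\<close> sends the pair \<open>(x, \<pi> a x)\<close> into the closure of the
  graph, and the relation defining the formal adjoint at \<open>y\<close> is closed, so it persists
  there.\<close>

lemma symmetrized_commutant_weak:
  fixes \<pi> :: "'a::complex_star_algebra \<Rightarrow> 'h::complex_hilbert \<Rightarrow> 'h"
  assumes rep: "star_rep D cinner \<pi>" and T: "T \<in> symmetrized_commutant D \<pi>"
    and x: "x \<in> D" and y: "y \<in> D"
  shows "cinner (T (\<pi> a x)) y = cinner (T x) (\<pi> (invol a) y)"
proof -
  interpret star_rep D cinner \<pi> by (rule rep)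
  let ?G = "op_graph D (\<pi> a)"
  have "closure ?G O op_graph UNIV T \<subseteq> op_graph UNIV T O closure ?G"
    using T by (auto simp: symmetrized_commutant_def Let_def)
  moreover have "(x, \<pi> a x) \<in> closure ?G"
    using x closure_subset by (fastforce simp: op_graph_def)
  ultimately have TG: "(T x, T (\<pi> a x)) \<in> closure ?G"
    by (fastforce simp: op_graph_def)
  have "closed {p. cinner (snd p) y = cinner (fst p) (\<pi> (invol a) y)}"
    by (intro closed_Collect_eq bounded_linear.continuous_on[OF bounded_linear_cinner_left]
        continuous_intros)
  moreover have "?G \<subseteq> {p. cinner (snd p) y = cinner (fst p) (\<pi> (invol a) y)}"
    using y by (auto simp: op_graph_def rep_invol)
  ultimately have "closure ?G \<subseteq> {p. cinner (snd p) y = cinner (fst p) (\<pi> (invol a) y)}"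
    by (rule closure_minimal[rotated])
  with TG show ?thesis by auto
qed

text \<open>The form on \<open>D \<times> D\<close> has the operator matrix with rows \<open>(1, r T\<^sup>*)\<close> and \<open>(r T, 1)\<close>. The factor
  \<open>r < 1\<close> makes it definite, so that no quotient has to be taken.\<close>

lemma commutant_overlap_scaled:
  fixes \<pi> :: "'a::complex_star_algebra \<Rightarrow> 'h::complex_hilbert \<Rightarrow> 'h"
  assumes rep: "star_rep D cinner \<pi>" and T: "T \<in> symmetrized_commutant D \<pi>" "onorm T \<le> 1"
    and \<phi>: "\<phi> \<in> realizing_vectors D cinner \<pi> f" and \<psi>: "\<psi> \<in> realizing_vectors D cinner \<pi> g"
    and r: "0 \<le> r" "r < 1"
  shows "(r * cmod (cinner (T \<phi>) \<psi>))\<^sup>2 \<le> transition_probability f g"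
proof -
  interpret star_rep D cinner \<pi> by (rule rep)
  note weak = symmetrized_commutant_weak[OF rep T(1)]
  have bl: "bounded_linear T" and TC: "\<And>c x. T (c *\<^sub>C x) = c *\<^sub>C T x"
    using T(1) by (auto simp: symmetrized_commutant_def bounded_clinear_def)
  have T_le: "norm (T x) \<le> norm x" for x
    using onorm[OF bl, of x] mult_right_mono[OF T(2), of "norm x"] by simp
  note T_simps = linear_add[OF bounded_linear.linear[OF bl]] linear_0[OF bounded_linear.linear[OF bl]] TC
  define ip where "ip = (\<lambda>x y. cinner (fst x) (fst y) + cinner (snd x) (snd y)
      + of_real r * (cinner (T (fst x)) (snd y) + cinner (snd x) (T (fst y))))"
  define \<rho> where "\<rho> = (\<lambda>a. map_prod (\<pi> a) (\<pi> a))"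
  \<comment> \<open>The cross term is at least \<open>- 2 * r * (norm u * norm v)\<close>, which the
    squares absorb up to the factor \<open>1 - r\<close>.\<close>
  have ip_self: "ip x x \<in> \<real> \<and> (1 - r) * ((norm (fst x))\<^sup>2 + (norm (snd x))\<^sup>2) \<le> Re (ip x x)" for x
  proof -
    obtain u v where x: "x = (u, v)" by force
    let ?s = "Re (cinner (T u) v)"
    have eq: "ip x x = of_real ((norm u)\<^sup>2 + (norm v)\<^sup>2 + 2 * r * ?s)"
      using cinner_commute[of v "T u"]
      by (simp add: x ip_def cinner_self complex_eq_iff)
    have "cmod (cinner (T u) v) \<le> norm u * norm v"
      using cmod_cinner_le[of "T u" v] mult_right_mono[OF T_le[of u], of "norm v"] by simp
    then have "- ?s \<le> norm u * norm v"
      using abs_Re_le_cmod[of "cinner (T u) v"] by linarith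
    then have "r * (- ?s) \<le> r * (norm u * norm v)"
      using r by (intro mult_left_mono)
    moreover have "2 * (norm u * norm v) \<le> (norm u)\<^sup>2 + (norm v)\<^sup>2"
      using sum_squares_bound[of "norm u" "norm v"] by simp
    then have "r * (2 * (norm u * norm v)) \<le> r * ((norm u)\<^sup>2 + (norm v)\<^sup>2)"
      using r by (intro mult_left_mono)
    ultimately have "(1 - r) * ((norm u)\<^sup>2 + (norm v)\<^sup>2) \<le> (norm u)\<^sup>2 + (norm v)\<^sup>2 + 2 * r * ?s"
      by (simp add: algebra_simps)
    then show ?thesis unfolding eq by (simp add: x)
  qed
  have \<rho>: "star_rep (D \<times> D) ip \<rho>"
  proof unfold_locales
    show "complex_vector.subspace (D \<times> D)"
      using subspace by (auto simp: complex_vector.subspace_def scaleC_prod_def zero_prod_def)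
    show "ip x y = cnj (ip y x)" for x y
      using cinner_commute[of "fst x" "fst y"] cinner_commute[of "snd x" "snd y"]
        cinner_commute[of "T (fst x)" "snd y"] cinner_commute[of "snd x" "T (fst y)"]
      by (simp add: ip_def)
    show "ip x x \<in> \<real>\<^sub>\<ge>\<^sub>0" for x
    proof -
      have "0 \<le> (1 - r) * ((norm (fst x))\<^sup>2 + (norm (snd x))\<^sup>2)" using r by simp
      then show ?thesis
        using ip_self[of x] by (auto simp: complex_nonneg_Reals_iff complex_is_Real_iff)
    qed
    show "x = 0" if "ip x x = 0" for x
    proof -
      have "(1 - r) * ((norm (fst x))\<^sup>2 + (norm (snd x))\<^sup>2) \<le> 0"
        using ip_self[of x] that by simp
      then have "(norm (fst x))\<^sup>2 + (norm (snd x))\<^sup>2 \<le> 0"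
        using r by (simp add: mult_le_0_iff)
      then show ?thesis by (simp add: sum_power2_le_zero_iff prod_eq_iff)
    qed
    show "ip (\<rho> a x) y = ip x (\<rho> (invol a) y)" if xy: "x \<in> D \<times> D" "y \<in> D \<times> D" for a x y
    proof -
      \<comment> \<open>The entry with the adjoint of \<open>T\<close> needs the weak relation
        conjugated, at \<open>invol a\<close>.\<close>
      have "cinner (\<pi> a (snd x)) (T (fst y)) = cinner (snd x) (T (\<pi> (invol a) (fst y)))"
        using weak[of "fst y" "snd x" "invol a"] xy
        by (metis cinner_commute invol_invol mem_Times_iff)
      then show ?thesis
        using xy weak by (auto simp: ip_def \<rho>_def rep_invol)
    qed
  qed (auto simp: ip_def \<rho>_def scaleC_prod_def T_simps cinner_add_left cinner_scaleC_left
      rep_closed rep_linear_add rep_linear_scaleC rep_add rep_scaleC rep_mult rep_one algebra_simps)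
  have zero: "\<pi> a 0 = 0" "0 \<in> D" for a
    using rep_linear_scaleC[of 0 a 0] complex_vector.subspace_0[OF subspace] by simp_all
  have czero: "cinner x 0 = 0" "cinner 0 x = 0" for x :: 'h
    using cinner_add_right[of x 0 0] cinner_add_left[of 0 0 x] by simp_all
  \<comment> \<open>The diagonal entries 1 leave \<open>f\<close> and \<open>g\<close> unchanged,
    and the overlap of the two vectors is the off-diagonal value
    \<open>r * cinner (T \<phi>) \<psi>\<close>.\<close>
  have "(\<phi>, 0) \<in> realizing_vectors (D \<times> D) ip \<rho> f" "(0, \<psi>) \<in> realizing_vectors (D \<times> D) ip \<rho> g"
    using \<phi> \<psi> by (auto simp: realizing_vectors_def ip_def \<rho>_def T_simps zero czero)
  from transition_probability_upper[OF \<rho> this] show ?thesis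
    using r by (simp add: ip_def T_simps czero norm_mult)
qed

text \<open>The factor is removed by letting it tend to 1: with \<open>r = sqrt s\<close>, the
  scaled bound holds for every \<open>s\<close> in the open unit interval.\<close>

lemma commutant_overlap_le:
  fixes \<pi> :: "'a::complex_star_algebra \<Rightarrow> 'h::complex_hilbert \<Rightarrow> 'h"
  assumes "star_rep D cinner \<pi>" "T \<in> symmetrized_commutant D \<pi>" "onorm T \<le> 1"
    and "\<phi> \<in> realizing_vectors D cinner \<pi> f" "\<psi> \<in> realizing_vectors D cinner \<pi> g"
  shows "(cmod (cinner (T \<phi>) \<psi>))\<^sup>2 \<le> transition_probability f g"
proof (rule field_le_mult_one_interval)
  fix s :: real assume "0 < s" "s < 1"
  then show "s * (cmod (cinner (T \<phi>) \<psi>))\<^sup>2 \<le> transition_probability f g"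
    using commutant_overlap_scaled[OF assms, of "sqrt s"] by (simp add: power_mult_distrib)
qed

section \<open>Equality of the two suprema\<close>

theorem theorem7:
  fixes f g :: "'a::complex_star_algebra \<Rightarrow> complex"
    and D\<^sub>f :: "'hf::complex_hilbert set" and \<pi>\<^sub>f :: "'a \<Rightarrow> 'hf \<Rightarrow> 'hf" and \<phi>\<^sub>f :: 'hf
    and D\<^sub>g :: "'hg::complex_hilbert set" and \<pi>\<^sub>g :: "'a \<Rightarrow> 'hg \<Rightarrow> 'hg" and \<phi>\<^sub>g :: 'hg
    and D :: "'h::complex_hilbert set" and \<pi> :: "'a \<Rightarrow> 'h \<Rightarrow> 'h" and \<phi> \<psi> :: 'h
  assumes "positive_functional f" and "positive_functional g"
    and "gns_representation f D\<^sub>f \<pi>\<^sub>f \<phi>\<^sub>f" and "essentially_self_adjoint D\<^sub>f \<pi>\<^sub>f"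
    and "gns_representation g D\<^sub>g \<pi>\<^sub>g \<phi>\<^sub>g" and "essentially_self_adjoint D\<^sub>g \<pi>\<^sub>g"
    and "hilbert_star_rep D \<pi>" and "biclosed D \<pi>"
    and "\<phi> \<in> realizing_vectors D cinner \<pi> f" and "\<psi> \<in> realizing_vectors D cinner \<pi> g"
  shows "transition_probability f g =
    (SUP T \<in> {T \<in> symmetrized_commutant D \<pi>. onorm T \<le> 1}. (cmod (cinner (T \<phi>) \<psi>))\<^sup>2)"
proof (rule antisym)
  have rep: "star_rep D cinner \<pi>" using assms(7) by (simp add: hilbert_star_rep_def)
  let ?\<T> = "{T \<in> symmetrized_commutant D \<pi>. onorm T \<le> 1}"
  let ?F = "\<lambda>T. (cmod (cinner (T \<phi>) \<psi>))\<^sup>2"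
  note realized = overlap_realized_by_commutant[OF assms(3-6) rep assms(8-10)]
  have le: "?F T \<le> transition_probability f g" if "T \<in> ?\<T>" for T
    using commutant_overlap_le[OF rep _ _ assms(9,10)] that by simp
  \<comment> \<open>The representation \<pi> with its own vectors \<open>\<phi>\<close> and
    \<open>\<psi>\<close> already supplies such an operator.\<close>
  have "?\<T> \<noteq> {}" using realized[OF rep assms(9,10)] by blast
  then show "Sup (?F ` ?\<T>) \<le> transition_probability f g"
    by (rule cSUP_least) (rule le)
  have bdd: "bdd_above (?F ` ?\<T>)" by (rule bdd_aboveI2) (rule le)
  show "transition_probability f g \<le> Sup (?F ` ?\<T>)"
    unfolding transition_probability_def
  proof (rule cSup_least)
    \<comment> \<open>A copy of \<pi>, restricted to the sum of the orbits of \<open>\<phi>\<close>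
      and \<open>\<psi>\<close>, lives on pairs of algebra elements.\<close>
    obtain E :: "('a \<times> 'a) set" and ip \<rho> x y where "star_rep E ip \<rho>"
      "x \<in> realizing_vectors E ip \<rho> f" "y \<in> realizing_vectors E ip \<rho> g"
      using star_rep_on_pairs[OF rep assms(9,10)] .
    then show "{(cmod (ip \<phi> \<psi>))\<^sup>2 | (D :: ('a \<times> 'a) set) ip \<pi> \<phi> \<psi>.
        star_rep D ip \<pi> \<and> \<phi> \<in> realizing_vectors D ip \<pi> f \<and> \<psi> \<in> realizing_vectors D ip \<pi> g} \<noteq> {}"
      by blast
  next
    fix s assume "s \<in> {(cmod (ip \<phi> \<psi>))\<^sup>2 | (D :: ('a \<times> 'a) set) ip \<pi> \<phi> \<psi>.
        star_rep D ip \<pi> \<and> \<phi> \<in> realizing_vectors D ip \<pi> f \<and> \<psi> \<in> realizing_vectors D ip \<pi> g}"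
    then obtain E :: "('a \<times> 'a) set" and ip \<rho> x y where \<rho>: "star_rep E ip \<rho>"
      "x \<in> realizing_vectors E ip \<rho> f" "y \<in> realizing_vectors E ip \<rho> g"
      and s: "s = (cmod (ip x y))\<^sup>2" by blast
    obtain T where "T \<in> ?\<T>" "cinner (T \<phi>) \<psi> = ip x y"
      using realized[OF \<rho>] by blast
    then show "s \<le> Sup (?F ` ?\<T>)"
      using cSUP_upper[OF _ bdd, of T] by (simp add: s)
  qed
qed

end
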